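(* Let $\beta>2$, $\bar Q>0$, $r_0>0$, $\bar R>0$, and consider the wideband Poisson network with path loss function $l(r)=r^{-\beta}$ and user density $\lambda_B=\kappa B$ with $\kappa>0$. Let $\rho=\kappa\pi r_0^2$ and $\bar P_0=r_0^{-\beta}\bar Q$. If $$\rho\bar R<C\!\left(\frac{\rho\bar P_0}{1+2\rho\bar P_0/(\beta-2)}\right)=C\!\left(\frac{\rho\bar P_0}{1+\frac{2\pi\kappa\bar Q}{r_0^{\beta-2}(\beta-2)}}\right),$$ then almost surely the OPT decoding condition is satisfied for all sufficiently large bandwidths $B$.
   Context: $C(x)=\log_2(1+x)$. Wideband Poisson network: a tagged receiver is at a location $y\in\mathbb{R}^2$ and its tagged transmitter is at a fixed non-random distance $r_0$ from it. For bandwidth $B>0$ the interferers form a homogeneous Poisson point process of intensity $\lambda_B$ in the plane; for different $B$ these are coupled by superposition: with $\Phi$ a Poisson point process on $\mathbb{R}^2\times[0,\infty)$ with Lebesgue intensity, the interferers at bandwidth $B$ are the points $x$ with $(x,u)\in\Phi$ and $u\le\lambda_B$. Each transmitter has fixed total transmit power $\bar Q$ (Watts), and each target data rate is $\bar R$ (bits/s). The tagged received power is $\bar P_0=l(r_0)\bar Q$ and the received powers from the interferers, $l(|x-y|)\bar Q$, are listed in decreasing order as $\bar I_1\ge\bar I_2\ge\cdots$. The noise power is $1$ Watt/Hz, so the per-Hz quantities are $R=\bar R/B$, $P_0=\bar P_0/B$, $I_j=\bar I_j/B$. OPT decoding condition: $R<R_{\mathrm{sym}}$, where, with $I[j:k]=\sum_{i=j}^kI_i$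 (zero for an empty range), $$R_{\mathrm{sym}}=\max_{k\ge0}\ \min_{l\in\{0,\dots,k\}}\frac1{l+1}C\!\left(\frac{P_0+I[k-l+1:k]}{1+I[k+1:\infty]}\right).$$ The quantity $\rho$ is the expected number of interferers per Hz within distance $r_0$ of the tagged receiver. *)

theory Defs
  imports "HOL-Probability.Probability"
begin

(* Realisations are sets of points: adequate for a diffuse intensity measure, where the process
   is almost surely simple. Counts are ennreal-valued so that infinite sets count as infinite. *)
definition point_count :: "('a \<Rightarrow> 'b set) \<Rightarrow> 'b set \<Rightarrow> 'a \<Rightarrow> ennreal" where
  "point_count \<Phi> A \<omega> = emeasure (count_space UNIV) (\<Phi> \<omega> \<inter> A)"

(* The Poisson probabilities are spelled out because poisson_pmf excludes rate 0. *)
definition poisson_point_process :: "'a measure \<Rightarrow> 'b measure \<Rightarrow> ('a \<Rightarrow> 'b set) \<Rightarrow> bool" where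
  "poisson_point_process M \<mu> \<Phi> \<longleftrightarrow>
     (\<forall>\<omega>\<in>space M. \<Phi> \<omega> \<subseteq> space \<mu>) \<and>
     (\<forall>A\<in>sets \<mu>. point_count \<Phi> A \<in> borel_measurable M) \<and>
     (\<forall>A\<in>sets \<mu>. emeasure \<mu> A < \<infinity> \<longrightarrow>
        (\<forall>n::nat. measure M {\<omega>\<in>space M. point_count \<Phi> A \<omega> = of_nat n}
           = exp (- measure \<mu> A) * measure \<mu> A ^ n / fact n)) \<and>
     (\<forall>(A :: nat \<Rightarrow> 'b set) n. (\<forall>i<n. A i \<in> sets \<mu>) \<longrightarrow> disjoint_family_on A {..<n} \<longrightarrow>
        prob_space.indep_vars M (\<lambda>_. borel) (\<lambda>i. point_count \<Phi> (A i)) {..<n})"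

definition space_mark_lebesgue :: "((real^2) \<times> real) measure" where
  "space_mark_lebesgue = restrict_space lborel (UNIV \<times> {0..})"

definition interferers :: "real \<Rightarrow> ((real^2) \<times> real) set \<Rightarrow> (real^2) set" where
  "interferers d S = {x. \<exists>u. (x, u) \<in> S \<and> u \<le> d}"

definition path_loss :: "real \<Rightarrow> real \<Rightarrow> real" where
  "path_loss \<beta> r = r powr (- \<beta>)"

(* I 1, I 2, ... are the values of f on the infinite set X, with multiplicity, in decreasing
   order; I 0 is irrelevant. Such a listing is unique when it exists. *)
definition lists_decreasingly :: "(nat \<Rightarrow> real) \<Rightarrow> ('b \<Rightarrow> real) \<Rightarrow> 'b set \<Rightarrow> bool" where
  "lists_decreasingly I f X \<longleftrightarrow>
     (\<exists>e. bij_betw e {1..} X \<and> (\<forall>j\<ge>1. I j = f (e j)) \<and> antimono_on {1..} I)"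

definition C :: "real \<Rightarrow> real" where
  "C x = log 2 (1 + x)"

(* For nonnegative summable I the terms lie in [0, C P0] and tend to 0 as k grows,
   so the supremum is a maximum. *)
definition R_sym :: "real \<Rightarrow> (nat \<Rightarrow> real) \<Rightarrow> real" where
  "R_sym P0 I =
     (SUP k::nat. MIN l\<in>{0..k}.
        1 / (real l + 1) * C ((P0 + (\<Sum>i=k-l+1..k. I i)) / (1 + (\<Sum>i. I (k + 1 + i)))))"

(* Parameters: path loss l, total power Qb, link distance r0, total rate Rb, receiver y,
   bandwidth B, set X of interferers. Summability only guards against the junk value of a divergent
   suminf: with infinite interference all the rates in R_sym would be 0 and decoding would fail. *)
definition opt_decodable ::
  "(real \<Rightarrow> real) \<Rightarrow> real \<Rightarrow> real \<Rightarrow> real \<Rightarrow> real^2 \<Rightarrow> real \<Rightarrow> (real^2) set \<Rightarrow> bool" where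
  "opt_decodable l Qb r0 Rb y B X \<longleftrightarrow>
     (\<exists>Ib. lists_decreasingly Ib (\<lambda>x. l (dist x y) * Qb) X \<and> summable Ib \<and>
           Rb / B < R_sym (l r0 * Qb / B) (\<lambda>j. Ib j / B))"

end

(* Only upper bounds on the numbers of interferers are needed. Take k to be the number of
   interferers within distance r0: each of them is received with power at least Pb0, so the numerator
   of the l-th rate in R_sym is at least (l + 1) Pb0 / B, and l + 1 <= k + 1 is at most about rho B.
   As C is concave with C 0 = 0, the condition is tightest at l + 1 = rho B, where it is the
   hypothesis up to an error that the strict inequality absorbs.

   The interference from outside r0 is compared with a geometric series over the annuli with radii
   r0 (1 + delta)^i. Chernoff's bound for the Poisson law and Borel-Cantelli along the bandwidths
   with lambda_B = k^2, applied to all annuli at once, control the number of points of every annulus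
   simultaneously; monotonicity in the bandwidth fills the gaps between consecutive squares. *)
theory Submission
  imports Defs "HOL-Real_Asymp.Real_Asymp"
begin

section \<open>Listing a locally finite set by distance\<close>

text \<open>Repeatedly remove a point that minimises \<open>d\<close>. Finiteness of the sublevel
  sets is used twice: it makes minima exist, and it forces every point to be removed at some
  stage.\<close>

lemma exists_increasing_listing:
  fixes d :: "'b \<Rightarrow> real"
  assumes inf: "infinite X" and fin: "\<And>r. finite {x\<in>X. d x \<le> r}"
  shows "\<exists>e. bij_betw e {1::nat..} X \<and> (\<forall>i\<ge>1. \<forall>j\<ge>i. d (e i) \<le> d (e j))"
proof -
  have ex: "\<exists>x. x \<in> Y \<and> (\<forall>z\<in>Y. d x \<le> d z)" if Y: "Y \<subseteq> X" "Y \<noteq> {}" for Y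
  proof -
    from Y obtain w where w: "w \<in> Y" by auto
    \<comment> \<open>Minimising over \<open>Y\<close> reduces to minimising over the finite set of
      points no worse than an arbitrary \<open>w\<close>.\<close>
    define F where "F = {x\<in>Y. d x \<le> d w}"
    have F: "finite F" "F \<noteq> {}"
      using Y w by (auto simp: F_def intro: finite_subset[OF _ fin[of "d w"]])
    define x where "x = arg_min_on d F"
    have "x \<in> F" using arg_min_if_finite(1)[OF F, of d] by (simp add: x_def)
    then have x: "x \<in> Y" "d x \<le> d w" by (simp_all add: F_def)
    have "d x \<le> d z" if "z \<in> Y" for z
    proof (cases "z \<in> F")
      case True
      then show ?thesis using arg_min_least[OF F] by (simp add: x_def)
    next
      case False
      then show ?thesis using x that by (simp add: F_def)
    qed
    with x show ?thesis by blast
  qed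
  define p where "p Y = (SOME x. x \<in> Y \<and> (\<forall>z\<in>Y. d x \<le> d z))" for Y
  have p: "p Y \<in> Y" "z \<in> Y \<Longrightarrow> d (p Y) \<le> d z" if "Y \<subseteq> X" "Y \<noteq> {}" for Y z
    using someI_ex[OF ex[OF that]] unfolding p_def by auto
  \<comment> \<open>\<open>S n\<close> is what remains of \<open>X\<close> after \<open>n\<close>
    removals, and \<open>p (S n)\<close> is the next point of the listing.\<close>
  define S where "S = rec_nat X (\<lambda>_ Y. Y - {p Y})"
  have S0: "S 0 = X" and SS: "S (Suc n) = S n - {p (S n)}" for n by (auto simp: S_def)
  have Sinf: "infinite (S n) \<and> S n \<subseteq> X" for n
    by (induction n) (auto simp: S0 SS inf)
  have Sne: "S n \<noteq> {}" for n using Sinf[of n] by auto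
  have Santi: "S n \<subseteq> S m" if "m \<le> n" for m n
    using that by (induction rule: dec_induct) (auto simp: SS)
  have pS: "p (S n) \<in> S n" "z \<in> S n \<Longrightarrow> d (p (S n)) \<le> d z" for n z
    using p[of "S n"] Sinf[of n] Sne[of n] by auto
  have mono: "d (p (S m)) \<le> d (p (S n))" if "m \<le> n" for m n
    using pS(2)[of _ m] pS(1)[of n] Santi[OF that] by auto
  have neq: "p (S m) \<noteq> p (S n)" if "m < n" for m n
    
  proof -
    have "p (S n) \<in> S (Suc m)" using pS(1)[of n] Santi[of "Suc m" n] that by auto
    then have "p (S n) \<noteq> p (S m)" unfolding SS by simp
    then show ?thesis by (rule not_sym)
  qed
  have injp: "inj (\<lambda>n. p (S n))"
    
  proof (rule injI)
    fix m n assume "p (S m) = p (S n)"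
    then show "m = n" using neq[of m n] neq[of n m] by (cases m n rule: linorder_cases) auto
  qed
  have surj: "x \<in> range (\<lambda>n. p (S n))" if x: "x \<in> X" for x
  proof (rule ccontr)
    assume nx: "x \<notin> range (\<lambda>n. p (S n))"
    \<comment> \<open>A point that is never removed stays a competitor at all stages, so all the
      removed points, infinitely many, would lie in its finite sublevel set.\<close>
    have xS: "x \<in> S n" for n
      by (induction n) (use nx x in \<open>auto simp: S0 SS\<close>)
    have "range (\<lambda>n. p (S n)) \<subseteq> {z\<in>X. d z \<le> d x}"
    proof (rule image_subsetI)
      fix n
      have "p (S n) \<in> X" using pS(1)[of n] Sinf[of n] by (elim conjE) (rule subsetD)
      moreover have "d (p (S n)) \<le> d x" by (rule pS(2)) (rule xS)
      ultimately show "p (S n) \<in> {z\<in>X. d z \<le> d x}" by simp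
    qed
    then have "finite (range (\<lambda>n. p (S n)))"
      by (rule finite_subset) (rule fin)
    then show False using finite_imageD[OF _ injp] by simp
  qed
  have b0: "bij_betw (\<lambda>n. p (S n)) UNIV X"
    unfolding bij_betw_def using injp surj pS(1) Sinf by auto
  \<comment> \<open>The removals are numbered from 0, the listing from 1.\<close>
  have "bij_betw (\<lambda>n. n - 1) {1::nat..} UNIV"
    by (rule bij_betwI[where g = Suc]) auto
  from bij_betw_trans[OF this b0]
  have "bij_betw ((\<lambda>n. p (S n)) \<circ> (\<lambda>n. n - 1)) {1::nat..} X" .
  then show ?thesis
    by (intro exI[of _ "(\<lambda>n. p (S n)) \<circ> (\<lambda>n. n - 1)"]) (simp add: mono diff_le_mono)
qed

section \<open>The rate function and a deterministic decoding criterion\<close>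

lemma C_mono: "0 \<le> a \<Longrightarrow> a \<le> b \<Longrightarrow> C a \<le> C b"
  by (simp add: C_def)

text \<open>Since \<open>C\<close> is concave and vanishes at 0, the slope of its chord from the
  origin decreases. Concavity of \<open>ln\<close> is applied between 1 and \<open>1 + t * a\<close>
  with weight \<open>s/t\<close>. This is what reduces the rates for all \<open>l\<close> to the
  single largest one.\<close>

lemma C_concave_at_0:
  assumes "0 < s" "s \<le> t" "0 \<le> a"
  shows "s * C (t * a) \<le> t * C (s * a)"
proof -
  have "(1 - s/t) * ln 1 + (s/t) * ln (1 + t*a) \<le> ln ((1 - s/t) * 1 + (s/t) * (1 + t*a))"
    using concave_onD[OF ln_concave, of "s/t" 1 "1 + t*a"] assms
    by (simp add: add_pos_nonneg)
  also have "(1 - s/t) * 1 + (s/t) * (1 + t*a) = 1 + s*a"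
    using assms by (simp add: field_simps)
  finally show ?thesis
    using assms by (simp add: C_def log_def field_simps)
qed

lemma path_loss_antimono:
  assumes "0 < \<beta>" "0 < a" "a \<le> b"
  shows "path_loss \<beta> b \<le> path_loss \<beta> a"
  using assms by (auto simp: path_loss_def intro!: powr_mono2')

text \<open>Separates geometry from probability: \<open>T\<close> bounds the interference per Hz
  from outside \<open>r0\<close>, and \<open>rate\<close> is the decoding inequality with each near
  interferer replaced by one at distance exactly \<open>r0\<close>. The index that witnesses the
  supremum in \<open>R_sym\<close> is the number of interferers within \<open>r0\<close>.\<close>

lemma opt_decodableI:
  fixes X :: "(real^2) set"
  assumes pos: "\<beta> > 0" "Qb > 0" "r0 > 0" "B > 0"
    and X: "infinite X" "y \<notin> X" "\<And>r. finite (X \<inter> cball y r)"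
    and T: "T \<ge> 0"
      "\<And>F. finite F \<Longrightarrow> F \<subseteq> X - cball y r0 \<Longrightarrow> (\<Sum>x\<in>F. path_loss \<beta> (dist x y) * Qb) \<le> B * T"
    and rate: "\<And>l. l \<le> card (X \<inter> cball y r0) \<Longrightarrow>
       (real l + 1) * (Rb / B) < C ((real l + 1) * (path_loss \<beta> r0 * Qb / B) / (1 + T))"
  shows "opt_decodable (path_loss \<beta>) Qb r0 Rb y B X"
proof -
  define g where "g x = path_loss \<beta> (dist x y) * Qb" for x
  have g0: "g x \<ge> 0" for x using pos by (simp add: g_def path_loss_def)
  have "\<exists>e. bij_betw e {1::nat..} X \<and> (\<forall>i\<ge>1. \<forall>j\<ge>i. dist (e i) y \<le> dist (e j) y)"
    using X(3) by (intro exists_increasing_listing X) (simp add: cball_def Int_def dist_commute)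
  then obtain e where e: "bij_betw e {1::nat..} X"
    and mono: "\<And>i j. 1 \<le> i \<Longrightarrow> i \<le> j \<Longrightarrow> dist (e i) y \<le> dist (e j) y" by blast
  have eX: "e j \<in> X" if "1 \<le> j" for j using e that by (auto simp: bij_betw_def)
  have einj: "inj_on e {1..}" using e by (simp add: bij_betw_def)
  define I where "I j = g (e j)" for j
  define k where "k = card (X \<inter> cball y r0)"
  have I0: "I j \<ge> 0" for j by (simp add: I_def g0)
  \<comment> \<open>Positivity matters: \<open>0 powr (- \<beta>)\<close> is 0, so an interferer at
    \<open>y\<close> itself would break the monotonicity of the powers.\<close>
  have dpos: "0 < dist (e j) y" if "1 \<le> j" for j using eX[OF that] X(2) by auto
  have anti: "antimono_on {1..} I"
    using dpos mono pos
    by (auto simp: monotone_on_def I_def g_def intro!: mult_right_mono path_loss_antimono)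
  have lists: "lists_decreasingly I (\<lambda>x. path_loss \<beta> (dist x y) * Qb) X"
    unfolding lists_decreasingly_def using e anti by (auto simp: I_def g_def)

  \<comment> \<open>The indices of the near interferers are closed downwards, as the listing is by
    distance, and there are \<open>k\<close> of them; hence they are exactly 1 to
    \<open>k\<close>.\<close>
  let ?J = "{j\<in>{1..}. e j \<in> cball y r0}"
  have eJ: "e ` ?J = X \<inter> cball y r0"
    using e by (auto simp: bij_betw_def)
  have cardJ: "card ?J = k"
    unfolding k_def eJ[symmetric] by (rule card_image[symmetric]) (auto intro: inj_on_subset[OF einj])
  have finJ: "finite ?J"
    using eJ X(3)[of r0] finite_imageD[of e ?J] inj_on_subset[OF einj, of ?J] by auto
  have down: "i \<in> ?J" if "j \<in> ?J" "1 \<le> i" "i \<le> j" for i j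
    using mono[of i j] that by (auto simp: dist_commute)
  have J: "?J = {1..k}"
  proof -
    have "{1..j} \<subseteq> ?J" if "j \<in> ?J" for j using down[OF that] by auto
    then have "j \<le> k" if "j \<in> ?J" for j using card_mono[OF finJ, of "{1..j}"] that cardJ by auto
    then have "?J \<subseteq> {1..k}" by auto
    then show ?thesis using card_subset_eq[of "{1..k}" ?J] cardJ by auto
  qed
  have near: "I j \<ge> path_loss \<beta> r0 * Qb" if "j \<in> {1..k}" for j
  proof -
    have "1 \<le> j" "dist (e j) y \<le> r0" using that unfolding J[symmetric] by (auto simp: dist_commute)
    then show ?thesis
      using dpos[of j] pos by (auto simp: I_def g_def intro!: mult_right_mono path_loss_antimono)
  qed
  have far: "e (k + 1 + i) \<in> X - cball y r0" for i
  proof -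
    have "k + 1 + i \<notin> ?J" unfolding J by auto
    then show ?thesis using eX[of "k+1+i"] by auto
  qed
  \<comment> \<open>The partial sums of the tail are sums over finite sets of far interferers. Their
    common bound gives both summability and the bound \<open>T\<close> on the tail per Hz.\<close>
  have psum: "(\<Sum>i<n. I (k + 1 + i)) \<le> B * T" for n
  proof -
    have inj: "inj_on (\<lambda>i. e (k+1+i)) {..<n}"
      
    proof (rule inj_onI)
      fix i j assume "e (k + 1 + i) = e (k + 1 + j)"
      then have "k + 1 + i = k + 1 + j" by (rule inj_onD[OF einj]) auto
      then show "i = j" by simp
    qed
    have "(\<Sum>i<n. I (k + 1 + i)) = (\<Sum>x\<in>(\<lambda>i. e (k+1+i)) ` {..<n}. g x)"
      by (subst sum.reindex[OF inj]) (simp add: I_def)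
    also have "\<dots> \<le> B * T"
      unfolding g_def using far by (intro T) auto
    finally show ?thesis .
  qed
  have sumk: "summable (\<lambda>i. I (k + 1 + i))"
    using psum[of "Suc _"] by (intro bounded_imp_summable[where B = "B * T"] I0) (simp add: lessThan_Suc_atMost)
  have sumI: "summable I"
    using sumk summable_iff_shift[of I "k+1"] by (simp add: add.commute)
  define P where "P = path_loss \<beta> r0 * Qb / B"
  have P0: "P \<ge> 0" using pos by (simp add: P_def path_loss_def)
  \<comment> \<open>Defined for every index, not only the chosen \<open>k\<close>, because the
    supremum must also be shown to be bounded.\<close>
  define tl where "tl k = (\<Sum>i. I (k + 1 + i) / B)" for k
  have tl0: "tl k \<ge> 0" for k
    unfolding tl_def
  proof (rule suminf_nonneg)
    have "summable (\<lambda>i. I (i + (k + 1)))" using sumI summable_iff_shift[of I "k+1"] by blast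
    then show "summable (\<lambda>i. I (k + 1 + i) / B)" by (intro summable_divide) (simp add: ac_simps)
  qed (use I0 pos in auto)
  have tlT: "tl k \<le> T"
    unfolding tl_def
  proof (rule suminf_le_const)
    show "summable (\<lambda>i. I (k + 1 + i) / B)" by (intro summable_divide sumk)
    show "(\<Sum>i<n. I (k + 1 + i) / B) \<le> T" for n
      using psum[of n] pos by (simp add: sum_divide_distrib[symmetric] pos_divide_le_eq mult.commute)
  qed
  define h where "h k l = 1 / (real l + 1) * C ((P + (\<Sum>i=k-l+1..k. I i / B)) / (1 + tl k))" for k l
  have h: "Rb / B < h k l" if l: "l \<le> k" for l
  proof -
    have "real l * P = (\<Sum>i=k-l+1..k. P)" using l by simp
    also have "\<dots> \<le> (\<Sum>i=k-l+1..k. I i / B)"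
      using near pos unfolding P_def by (intro sum_mono divide_right_mono) auto
    finally have s: "(real l + 1) * P \<le> P + (\<Sum>i=k-l+1..k. I i / B)" by (simp add: algebra_simps)
    have "(real l + 1) * (Rb / B) < C ((real l + 1) * P / (1 + T))"
      using rate[of l] l by (simp add: P_def k_def)
    also have "\<dots> \<le> C ((P + (\<Sum>i=k-l+1..k. I i / B)) / (1 + tl k))"
    proof (rule C_mono)
      show "(real l + 1) * P / (1 + T) \<le> (P + (\<Sum>i=k-l+1..k. I i / B)) / (1 + tl k)"
        using tl0[of k] tlT T(1) s P0 by (intro frac_le order_trans[OF _ s]) auto
    qed (use P0 T(1) in auto)
    finally show ?thesis by (simp add: h_def field_simps)
  qed
  have "Rb / B < (MIN l\<in>{0..k}. h k l)"
    using h by auto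
  also have "\<dots> \<le> (SUP k. MIN l\<in>{0..k}. h k l)"
  proof (rule cSUP_upper)
    \<comment> \<open>A conditionally complete supremum dominates its terms only if they are
      bounded. At \<open>l = 0\<close> the range of decoded interferers is empty, which leaves at
      most \<open>C P\<close>.\<close>
    show "bdd_above (range (\<lambda>k. MIN l\<in>{0..k}. h k l))"
    proof (rule bdd_aboveI2)
      fix k :: nat
      have "(MIN l\<in>{0..k}. h k l) \<le> h k 0" by (intro Min_le) auto
      also have "\<dots> = C (P / (1 + tl k))" by (simp add: h_def)
      also have "\<dots> \<le> C P" 
        using tl0[of k] P0 by (intro C_mono) (auto simp: divide_le_eq mult_le_cancel_left1 distrib_left)
      finally show "(MIN l\<in>{0..k}. h k l) \<le> C P" .
    qed
  qed simp
  also have "\<dots> = R_sym P (\<lambda>j. I j / B)"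
    unfolding R_sym_def h_def tl_def ..
  finally show ?thesis
    unfolding opt_decodable_def using lists sumI unfolding P_def by blast
qed

section \<open>Upper tails of Poisson counts\<close>

text \<open>This is the strict inequality \<open>ln u < u - 1\<close> at
  \<open>u = 1 / (1 + e)\<close>.\<close>

lemma poisson_chernoff_exponent_pos:
  assumes "0 < (e::real)"
  shows "0 < (1 + e) * ln (1 + e) - e"
proof -
  have "ln (1 / (1 + e)) < 1 / (1 + e) - 1"
    using assms ln_eq_minus_one[of "1 / (1 + e)"] ln_le_minus_one[of "1 / (1 + e)"]
    by (auto simp: order.strict_iff_order)
  then show ?thesis using assms by (simp add: ln_div field_simps)
qed

text \<open>Chernoff's bound with the optimal tilt \<open>z = 1 + e\<close>. The tail is written as
  one minus a finite sum, the form in which it arises from probabilities of single counts.\<close>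

lemma poisson_upper_tail:
  fixes m e :: real
  assumes m: "0 \<le> m" and e: "0 < e"
  shows "1 - (\<Sum>n\<in>{n. real n \<le> (1 + e) * m}. exp (- m) * m ^ n / fact n)
           \<le> exp (- (((1 + e) * ln (1 + e) - e) * m))"
proof -
  define p where "p n = exp (- m) * m ^ n / fact n" for n
  define S where "S = {n. real n \<le> (1 + e) * m}"
  have finS: "finite S"
    by (rule finite_subset[of _ "{..nat \<lfloor>(1 + e) * m\<rfloor>}"]) (auto simp: S_def le_nat_floor)
  have pois: "(\<lambda>n. exp (- m) * (m * z) ^ n / fact n) sums exp (m * z - m)" for z
    using sums_mult[OF exp_converges[of "m * z"], of "exp (- m)"]
    by (simp add: exp_minus exp_diff field_simps)
  have 1: "(\<lambda>n. p n) sums 1" using pois[of 1] by (simp add: p_def)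
  have 2: "(\<lambda>n. if n \<in> S then p n else 0) sums (\<Sum>n\<in>S. p n)"
    by (rule sums_If_finite_set[OF finS])
  have 3: "(\<lambda>n. if n \<in> S then 0 else p n) sums (1 - (\<Sum>n\<in>S. p n))"
    by (rule sums_cong[THEN iffD1, OF _ sums_diff[OF 1 2]]) auto
  \<comment> \<open>Normalised so that \<open>w * (1 + e) ^ n\<close> equals 1 at
    \<open>n = (1 + e) * m\<close>; beyond that point it is at least 1 and dominates the indicator
    of the tail.\<close>
  define w where "w = exp (- ((1 + e) * m * ln (1 + e)))"
  have 4: "(\<lambda>n. w * (exp (- m) * (m * (1 + e)) ^ n / fact n)) sums (w * exp (m * (1 + e) - m))"
    by (intro sums_mult pois)
  have "1 - (\<Sum>n\<in>S. p n) \<le> w * exp (m * (1 + e) - m)"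
  proof (rule sums_le[OF _ 3 4])
    fix n
    have "1 \<le> w * (1 + e) ^ n" if "n \<notin> S"
    proof -
      have "(1 + e) * m * ln (1 + e) \<le> real n * ln (1 + e)"
        using that e by (intro mult_right_mono) (auto simp: S_def)
      then have "1 \<le> w * exp (real n * ln (1 + e))"
        by (simp add: w_def exp_add[symmetric])
      then show ?thesis using e by (simp add: exp_of_nat_mult)
    qed
    moreover have "0 \<le> p n" "0 \<le> w" using m by (auto simp: p_def w_def)
    ultimately have "(if n \<in> S then 0 else p n) \<le> p n * (w * (1 + e) ^ n)"
      using e by (auto simp: mult_le_cancel_left1 order.strict_iff_order)
    also have "p n * (w * (1 + e) ^ n) = w * (exp (- m) * (m * (1 + e)) ^ n / fact n)"
      unfolding p_def power_mult_distrib by simp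
    finally show "(if n \<in> S then 0 else p n) \<le> w * (exp (- m) * (m * (1 + e)) ^ n / fact n)" .
  qed
  also have "w * exp (m * (1 + e) - m) = exp (- (((1 + e) * ln (1 + e) - e) * m))"
    by (simp add: w_def exp_add[symmetric] algebra_simps)
  finally show ?thesis by (simp add: S_def p_def)
qed

lemma poisson_count_upper_tail:
  assumes M: "prob_space M" and P: "poisson_point_process M \<mu> \<Phi>"
    and A: "A \<in> sets \<mu>" "emeasure \<mu> A < \<infinity>" and e: "0 < e"
  shows "measure M {\<omega>\<in>space M. \<not> point_count \<Phi> A \<omega> \<le> ennreal ((1 + e) * measure \<mu> A)}
           \<le> exp (- (((1 + e) * ln (1 + e) - e) * measure \<mu> A))"
proof -
  interpret prob_space M by fact
  define m where "m = measure \<mu> A"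
  define S where "S = {n. real n \<le> (1 + e) * m}"
  have m: "0 \<le> m" by (simp add: m_def)
  have finS: "finite S"
    by (rule finite_subset[of _ "{..nat \<lfloor>(1 + e) * m\<rfloor>}"]) (auto simp: S_def le_nat_floor)
  have meas[measurable]: "point_count \<Phi> A \<in> borel_measurable M"
    using P A by (auto simp: poisson_point_process_def)
  define E where "E n = {\<omega>\<in>space M. point_count \<Phi> A \<omega> = of_nat n}" for n
  have E[measurable]: "E n \<in> sets M" for n unfolding E_def by measurable
  have probE: "prob (E n) = exp (- m) * m ^ n / fact n" for n
    using P A by (auto simp: poisson_point_process_def E_def m_def)
  have "disjoint_family_on E S" by (auto simp: disjoint_family_on_def E_def)
  then have U: "prob (\<Union>n\<in>S. E n) = (\<Sum>n\<in>S. exp (- m) * m ^ n / fact n)"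
    using finite_measure_finite_Union[OF finS, of E] by (simp add: probE image_subset_iff)
  have "point_count \<Phi> A \<omega> \<le> ennreal ((1 + e) * m)" if "n \<in> S" "\<omega> \<in> E n" for n \<omega>
    using that by (auto simp: S_def E_def ennreal_of_nat_eq_real_of_nat intro!: ennreal_leI)
  \<comment> \<open>Passing to the complement of the small finite counts also covers the event of an
    infinite count.\<close>
  then have "prob {\<omega>\<in>space M. \<not> point_count \<Phi> A \<omega> \<le> ennreal ((1 + e) * m)} \<le> prob (space M - (\<Union>n\<in>S. E n))"
    using finS by (intro finite_measure_mono sets.Diff sets.finite_UN) auto
  also have "\<dots> = 1 - (\<Sum>n\<in>S. exp (- m) * m ^ n / fact n)"
    using finS U by (subst prob_compl) (auto intro!: sets.finite_UN)
  also have "\<dots> \<le> exp (- (((1 + e) * ln (1 + e) - e) * m))"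
    unfolding S_def by (rule poisson_upper_tail[OF m e])
  finally show ?thesis by (simp add: m_def)
qed

section \<open>Void probabilities\<close>

lemma poisson_void_probability:
  assumes "poisson_point_process M \<mu> \<Phi>" "A \<in> sets \<mu>" "emeasure \<mu> A < \<infinity>"
  shows "measure M {\<omega>\<in>space M. \<Phi> \<omega> \<inter> A = {}} = exp (- measure \<mu> A)"
proof -
  have "{\<omega>\<in>space M. \<Phi> \<omega> \<inter> A = {}} = {\<omega>\<in>space M. point_count \<Phi> A \<omega> = of_nat 0}"
    by (auto simp: point_count_def emeasure_count_space_eq_0)
  moreover have "measure M {\<omega>\<in>space M. point_count \<Phi> A \<omega> = of_nat 0}
      = exp (- measure \<mu> A) * measure \<mu> A ^ 0 / fact 0"
    using assms unfolding poisson_point_process_def by blast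
  ultimately show ?thesis by simp
qed

lemma sets_poisson_void:
  assumes "poisson_point_process M \<mu> \<Phi>" "A \<in> sets \<mu>"
  shows "{\<omega>\<in>space M. \<Phi> \<omega> \<inter> A = {}} \<in> sets M"
proof -
  have [measurable]: "point_count \<Phi> A \<in> borel_measurable M"
    using assms by (auto simp: poisson_point_process_def)
  have "{\<omega>\<in>space M. \<Phi> \<omega> \<inter> A = {}} = {\<omega>\<in>space M. point_count \<Phi> A \<omega> = 0}"
    by (auto simp: point_count_def emeasure_count_space_eq_0)
  then show ?thesis by simp
qed

lemma poisson_null_set_AE_empty:
  assumes M: "prob_space M" and P: "poisson_point_process M \<mu> \<Phi>"
    and A: "A \<in> sets \<mu>" "emeasure \<mu> A = 0"
  shows "AE \<omega> in M. \<Phi> \<omega> \<inter> A = {}"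
proof -
  interpret prob_space M by fact
  have "prob {\<omega>\<in>space M. \<Phi> \<omega> \<inter> A = {}} = 1"
    using poisson_void_probability[OF P A(1)] A(2) by (simp add: measure_def)
  then show ?thesis using prob_Collect_eq_1[OF sets_poisson_void[OF P A(1)]] by simp
qed

text \<open>If \<open>A'\<close> contains no point then neither does any \<open>A n\<close>, and the
  void probabilities \<open>exp (- measure \<mu> (A n))\<close> tend to 0.\<close>

lemma poisson_infinite_measure_AE_nonempty:
  assumes M: "prob_space M" and P: "poisson_point_process M \<mu> \<Phi>"
    and A: "\<And>n. A n \<in> sets \<mu>" "\<And>n. A n \<subseteq> A'" "\<And>n. emeasure \<mu> (A n) < \<infinity>"
    and lim: "filterlim (\<lambda>n. measure \<mu> (A n)) at_top sequentially"
  shows "AE \<omega> in M. \<Phi> \<omega> \<inter> A' \<noteq> {}"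
proof -
  interpret prob_space M by fact
  let ?N = "\<Inter>n::nat. {\<omega>\<in>space M. \<Phi> \<omega> \<inter> A n = {}}"
  have N: "?N \<in> sets M" using sets_poisson_void[OF P A(1)] by (intro sets.countable_INT) auto
  have "prob ?N \<le> exp (- measure \<mu> (A n))" for n
    unfolding poisson_void_probability[OF P A(1) A(3), symmetric]
    using sets_poisson_void[OF P A(1)] by (intro finite_measure_mono) auto
  moreover have "(\<lambda>n. exp (- measure \<mu> (A n))) \<longlonglongrightarrow> 0"
    using lim by (intro filterlim_compose[OF exp_at_bot]) (simp add: filterlim_uminus_at_top)
  ultimately have "prob ?N \<le> 0" by (intro LIMSEQ_le_const) auto
  then have "?N \<in> null_sets M" using N measure_nonneg[of M ?N] by (simp add: null_sets_def emeasure_eq_measure)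
  moreover have "{\<omega>\<in>space M. \<not> \<Phi> \<omega> \<inter> A' \<noteq> {}} \<subseteq> ?N" using A(2) by blast
  ultimately show ?thesis by (rule AE_I')
qed

section \<open>Volumes of slabs, discs and rings\<close>

lemma space_mark_lebesgue_Times:
  assumes "A \<in> sets lborel" "D \<in> sets lborel" "D \<subseteq> {0..}"
  shows "A \<times> D \<in> sets space_mark_lebesgue"
    and "emeasure space_mark_lebesgue (A \<times> D) = emeasure lborel A * emeasure lborel D"
proof -
  have prod: "S \<times> T \<in> sets lborel" if "S \<in> sets lborel" "T \<in> sets lborel" for S :: "(real^2) set" and T :: "real set"
    using that pair_measureI[of S lborel T lborel] by (simp only: lborel_prod)
  have U: "UNIV \<times> {0..} \<inter> space lborel \<in> sets (lborel :: ((real^2)\<times>real) measure)"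
    using prod[of UNIV "{0..}"] by simp
  show "A \<times> D \<in> sets space_mark_lebesgue"
    using prod[OF assms(1,2)] assms(3) U unfolding space_mark_lebesgue_def
    by (subst sets_restrict_space_iff) auto
  have "emeasure space_mark_lebesgue (A \<times> D) = emeasure lborel (A \<times> D)"
    using assms(3) U unfolding space_mark_lebesgue_def
    by (subst emeasure_restrict_space) auto
  also have "\<dots> = emeasure lborel A * emeasure lborel D"
    using lborel.emeasure_pair_measure_Times[of A lborel D] assms by (simp only: lborel_prod)
  finally show "emeasure space_mark_lebesgue (A \<times> D) = emeasure lborel A * emeasure lborel D" .
qed

lemma space_mark_lebesgue_slab:
  assumes A: "A \<in> sets lborel" "emeasure lborel A < \<infinity>" and d: "0 \<le> d"
  shows "A \<times> {0..d} \<in> sets space_mark_lebesgue"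
    and "emeasure space_mark_lebesgue (A \<times> {0..d}) < \<infinity>"
    and "measure space_mark_lebesgue (A \<times> {0..d}) = d * measure lborel A"
proof -
  show "A \<times> {0..d} \<in> sets space_mark_lebesgue" using A by (intro space_mark_lebesgue_Times) auto
  have *: "emeasure space_mark_lebesgue (A \<times> {0..d}) = emeasure lborel A * ennreal d"
    using A d by (subst space_mark_lebesgue_Times) auto
  then show "emeasure space_mark_lebesgue (A \<times> {0..d}) < \<infinity>"
    using A by (simp add: ennreal_mult_less_top)
  show "measure space_mark_lebesgue (A \<times> {0..d}) = d * measure lborel A"
    using * d by (simp add: measure_def enn2real_mult)
qed

lemma lborel_cball_plane:
  fixes y :: "real^2"
  assumes "0 \<le> r"
  shows "emeasure lborel (cball y r) = ennreal (pi * r\<^sup>2)" "measure lborel (cball y r) = pi * r\<^sup>2"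
proof -
  show "emeasure lborel (cball y r) = ennreal (pi * r\<^sup>2)"
    using emeasure_cball[OF assms, of y] by (simp add: unit_ball_vol_2)
  then show "measure lborel (cball y r) = pi * r\<^sup>2" using assms by (simp add: measure_def)
qed

lemma lborel_ring_plane:
  fixes y :: "real^2"
  assumes "0 \<le> r" "r \<le> s"
  shows "emeasure lborel (cball y s - cball y r) < \<infinity>"
    "measure lborel (cball y s - cball y r) = pi * (s\<^sup>2 - r\<^sup>2)"
proof -
  have "emeasure lborel (cball y s - cball y r) \<le> emeasure lborel (cball y s)"
    by (intro emeasure_mono) auto
  then show "emeasure lborel (cball y s - cball y r) < \<infinity>"
    using assms lborel_cball_plane(1)[of s y] by (auto intro: order_le_less_trans)
  have "measure lborel (cball y s - cball y r) = measure lborel (cball y s) - measure lborel (cball y r)"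
    using assms by (intro measure_Diff) (auto simp: lborel_cball_plane dist_norm)
  then show "measure lborel (cball y s - cball y r) = pi * (s\<^sup>2 - r\<^sup>2)"
    using assms by (simp add: lborel_cball_plane right_diff_distrib)
qed

section \<open>A law of large numbers uniform over countably many regions\<close>

text \<open>The threshold for \<open>d\<close> must not depend on \<open>i\<close>. Summability of
  the reciprocal areas makes the union bound over \<open>i\<close> finite, and along the squares
  \<open>d = k^2\<close> the remaining factor is summable in \<open>k\<close>.\<close>

lemma poisson_upper_law_of_large_numbers:
  fixes A :: "nat \<Rightarrow> (real^2) set"
  assumes M: "prob_space M" and P: "poisson_point_process M space_mark_lebesgue \<Phi>"
    and A: "\<And>i. A i \<in> sets lborel" "\<And>i. emeasure lborel (A i) < \<infinity>"
      "\<And>i. 0 < measure lborel (A i)" "summable (\<lambda>i. 1 / measure lborel (A i))"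
    and \<delta>: "0 < \<delta>"
  shows "AE \<omega> in M. \<forall>\<^sub>F d in at_top. \<forall>i.
           point_count \<Phi> (A i \<times> {0..d}) \<omega> \<le> ennreal ((1 + \<delta>) * d * measure lborel (A i))"
proof -
  interpret prob_space M by fact
  \<comment> \<open>Half of the slack goes into Chernoff's bound, the rest into passing from
    \<open>d\<close> to the next square.\<close>
  define e where "e = \<delta> / 2"
  have e: "0 < e" using \<delta> by (simp add: e_def)
  define c where "c = (1 + e) * ln (1 + e) - e"
  have c: "0 < c" unfolding c_def by (rule poisson_chernoff_exponent_pos[OF e])
  define a where "a i = measure lborel (A i)" for i
  have a: "0 < a i" for i using A(3) by (simp add: a_def)
  define Bad where "Bad k i = {\<omega>\<in>space M.
      \<not> point_count \<Phi> (A i \<times> {0..real k ^ 2}) \<omega> \<le> ennreal ((1 + e) * (real k ^ 2 * a i))}" for k i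
  note slab = space_mark_lebesgue_slab[OF A(1,2) zero_le_power2]
  have Bad_sets: "Bad k i \<in> sets M" for k i
  proof -
    have [measurable]: "point_count \<Phi> (A i \<times> {0..real k ^ 2}) \<in> borel_measurable M"
      using P slab(1)[of i "real k"] by (auto simp: poisson_point_process_def)
    show ?thesis unfolding Bad_def by measurable
  qed
  have Bad_prob: "prob (Bad k i) \<le> (1 / (c * real k ^ 2)) * (1 / a i)" if "0 < k" for k i
  proof -
    define m where "m = real k ^ 2 * a i"
    have m: "0 < m" using a that by (simp add: m_def)
    have "prob (Bad k i) \<le> exp (- (c * m))"
      using poisson_count_upper_tail[OF M P slab(1,2) e, of i "real k"]
      by (simp add: Bad_def c_def m_def a_def slab(3))
    \<comment> \<open>The crude bound \<open>exp (- x) \<le> 1 / x\<close> suffices and separates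
      the dependence on \<open>k\<close> from that on \<open>i\<close>.\<close>
    also have "\<dots> \<le> 1 / (c * m)"
    proof -
      have "c * m \<le> exp (c * m)" using exp_ge_add_one_self[of "c * m"] by linarith
      moreover have "0 < c * m" using c m by simp
      ultimately have "1 / exp (c * m) \<le> 1 / (c * m)" by (intro frac_le) auto
      then show ?thesis by (simp add: exp_minus inverse_eq_divide)
    qed
    finally show ?thesis by (simp add: m_def mult.assoc)
  qed
  define BB where "BB k = (\<Union>i. Bad (Suc k) i)" for k
  have BB_sets: "BB k \<in> sets M" for k using Bad_sets by (auto simp: BB_def)
  have sa: "summable (\<lambda>i. w * (1 / a i))" for w
    using A(4) by (intro summable_mult) (simp add: a_def)
  have BB_prob: "prob (BB k) \<le> (1 / c * (\<Sum>i. 1 / a i)) * (1 / real (Suc k) ^ 2)" for k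
  proof -
    have s: "summable (\<lambda>i. prob (Bad (Suc k) i))"
      by (rule summable_comparison_test'[OF sa[of "1 / (c * real (Suc k) ^ 2)"], of 0])
        (use Bad_prob[of "Suc k"] in simp)
    have "prob (BB k) \<le> (\<Sum>i. prob (Bad (Suc k) i))"
      unfolding BB_def using Bad_sets s by (intro finite_measure_subadditive_countably) auto
    also have "\<dots> \<le> (\<Sum>i. (1 / (c * real (Suc k) ^ 2)) * (1 / a i))"
      by (intro suminf_le Bad_prob s sa) simp
    also have "\<dots> = (1 / (c * real (Suc k) ^ 2)) * (\<Sum>i. 1 / a i)"
      using A(4) by (intro suminf_mult) (simp add: a_def)
    finally show ?thesis by simp
  qed
  have "summable (\<lambda>k. 1 / real (Suc k) ^ 2)"
    using inverse_power_summable[of 2, where 'a = real] summable_Suc_iff[of "\<lambda>k. 1 / real k ^ 2"]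
    by (simp add: inverse_eq_divide)
  then have "summable (\<lambda>k. (1 / c * (\<Sum>i. 1 / a i)) * (1 / real (Suc k) ^ 2))"
    by (rule summable_mult)
  then have "summable (\<lambda>k. prob (BB k))"
    by (rule summable_comparison_test'[where N = 0]) (simp only: real_norm_def abs_of_nonneg[OF measure_nonneg] BB_prob)
  then have "AE \<omega> in M. \<forall>\<^sub>F k in sequentially. \<omega> \<in> space M - BB k"
    using BB_sets by (intro borel_cantelli_AE1) (auto simp: emeasure_eq_measure)
  then show ?thesis
  proof eventually_elim
    case (elim \<omega>)
    then obtain K where K: "\<And>k. K \<le> k \<Longrightarrow> \<omega> \<in> space M - BB k"
      by (auto simp: eventually_sequentially)
    have "\<forall>\<^sub>F d in at_top. real K + 1 < sqrt d"
      by real_asymp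
    \<comment> \<open>Consecutive squares have ratio tending to 1, so the overshoot is eventually
      below \<open>(1 + \<delta>) / (1 + e)\<close>.\<close>
    moreover have "\<forall>\<^sub>F d in at_top. (1 + e) * (sqrt d + 1)\<^sup>2 \<le> (1 + \<delta>) * d"
    proof -
      have "((\<lambda>d. (sqrt d + 1)\<^sup>2 / d) \<longlongrightarrow> 1) at_top" by real_asymp
      moreover have "1 < (1 + \<delta>) / (1 + e)" using \<delta> by (simp add: e_def)
      ultimately have "\<forall>\<^sub>F d in at_top. (sqrt d + 1)\<^sup>2 / d < (1 + \<delta>) / (1 + e)"
        by (rule order_tendstoD)
      then show ?thesis
        using eventually_gt_at_top[of 0]
      proof eventually_elim
        case (elim d)
        then have "(sqrt d + 1)\<^sup>2 \<le> (1 + \<delta>) / (1 + e) * d"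
          by (intro less_imp_le) (simp only: pos_divide_less_eq)
        then have "(1 + e) * (sqrt d + 1)\<^sup>2 \<le> (1 + e) * ((1 + \<delta>) / (1 + e) * d)"
          using e by (intro mult_left_mono) auto
        also have "\<dots> = (1 + \<delta>) * d" using e by simp
        finally show ?case .
      qed
    qed
    moreover have "\<forall>\<^sub>F d::real in at_top. 0 < d" by (rule eventually_gt_at_top)
    ultimately show ?case
    proof eventually_elim
      case (elim d)
      \<comment> \<open>The least \<open>k\<close> with \<open>d \<le> k^2\<close>. Counts increase
        with \<open>d\<close>, so the bound at \<open>k^2\<close> serves at
        \<open>d\<close>.\<close>
      define k where "k = nat \<lceil>sqrt d\<rceil>"
      have k: "sqrt d \<le> real k" "real k \<le> sqrt d + 1"
        using elim(3) by (auto simp: k_def of_nat_nat)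
      then have "K + 1 < k" using elim(1) by linarith
      then obtain k' where k': "k = Suc k'" "K \<le> k'" by (cases k) auto
      have dk: "d \<le> real k ^ 2"
        using power_mono[OF k(1), of 2] elim(3) by simp
      have "real k ^ 2 \<le> (sqrt d + 1)\<^sup>2" using k(2) by (intro power_mono) auto
      then have kd: "(1 + e) * real k ^ 2 \<le> (1 + \<delta>) * d"
        using elim(2) e by (intro order_trans[OF mult_left_mono elim(2)]) auto
      show ?case
      proof
        fix i
        have "point_count \<Phi> (A i \<times> {0..d}) \<omega> \<le> point_count \<Phi> (A i \<times> {0..real k ^ 2}) \<omega>"
          unfolding point_count_def using dk by (intro emeasure_mono) auto
        also have "\<dots> \<le> ennreal ((1 + e) * (real k ^ 2 * a i))"
          using K[OF k'(2)] by (auto simp: BB_def Bad_def k'(1))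
        also have "\<dots> \<le> ennreal ((1 + \<delta>) * d * a i)"
          using mult_right_mono[OF kd, of "a i"] a[of i] by (intro ennreal_leI) (simp add: mult.assoc)
        finally show "point_count \<Phi> (A i \<times> {0..d}) \<omega> \<le> ennreal ((1 + \<delta>) * d * measure lborel (A i))"
          by (simp add: a_def)
      qed
    qed
  qed
qed

section \<open>From point counts to interferers\<close>

text \<open>As marks are nonnegative, the interferers in \<open>A\<close> are the projection of the
  points in the slab over \<open>A\<close>, and a projection does not increase cardinality.\<close>

lemma interferers_Int_finite:
  assumes "point_count \<Phi> (A \<times> {0..d}) \<omega> \<le> ennreal b" "\<Phi> \<omega> \<subseteq> UNIV \<times> {0..}" "0 \<le> b"
  shows "finite (interferers d (\<Phi> \<omega>) \<inter> A)" "real (card (interferers d (\<Phi> \<omega>) \<inter> A)) \<le> b"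
proof -
  let ?S = "\<Phi> \<omega> \<inter> A \<times> {0..d}"
  have fin: "finite ?S"
  proof (rule ccontr)
    assume "infinite ?S"
    then have "point_count \<Phi> (A \<times> {0..d}) \<omega> = \<infinity>"
      unfolding point_count_def by (subst emeasure_count_space_infinite) simp_all
    with assms(1) show False by (simp only: infinity_ennreal_def top_unique ennreal_neq_top)
  qed
  have sub: "interferers d (\<Phi> \<omega>) \<inter> A = fst ` ?S"
  proof (intro equalityI subsetI)
    fix x assume "x \<in> interferers d (\<Phi> \<omega>) \<inter> A"
    then obtain u where "(x, u) \<in> \<Phi> \<omega>" "u \<le> d" "x \<in> A" by (auto simp: interferers_def)
    with assms(2) have "(x, u) \<in> ?S" by auto
    then show "x \<in> fst ` ?S" by (rule image_eqI[rotated]) simp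
  qed (auto simp: interferers_def)
  show "finite (interferers d (\<Phi> \<omega>) \<inter> A)" unfolding sub using fin by simp
  have "point_count \<Phi> (A \<times> {0..d}) \<omega> = ennreal (real (card ?S))"
    unfolding point_count_def using fin
    by (subst emeasure_count_space_finite) (simp_all only: subset_UNIV ennreal_of_nat_eq_real_of_nat)
  with assms(1) have "ennreal (real (card ?S)) \<le> ennreal b" by (simp only:)
  then have "real (card ?S) \<le> b" using assms(3) by (simp add: ennreal_le_iff)
  then show "real (card (interferers d (\<Phi> \<omega>) \<inter> A)) \<le> b"
    unfolding sub using card_image_le[OF fin, of fst] by linarith
qed

text \<open>The whole fibre over \<open>y\<close> is a null set, so one exceptional event serves all
  densities \<open>d\<close> at once.\<close>

lemma AE_receiver_notin_interferers:
  assumes "prob_space M" "poisson_point_process M space_mark_lebesgue \<Phi>"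
  shows "AE \<omega> in M. \<forall>d. y \<notin> interferers d (\<Phi> \<omega>)"
proof -
  have "AE \<omega> in M. \<Phi> \<omega> \<inter> ({y} \<times> {0..}) = {}"
    by (rule poisson_null_set_AE_empty[OF assms])
      (auto intro: space_mark_lebesgue_Times simp: space_mark_lebesgue_Times)
  then show ?thesis
  proof (rule AE_mp, intro AE_I2 impI allI notI)
    fix \<omega> d assume "\<omega> \<in> space M" "\<Phi> \<omega> \<inter> ({y} \<times> {0..}) = {}" "y \<in> interferers d (\<Phi> \<omega>)"
    moreover have "\<Phi> \<omega> \<subseteq> UNIV \<times> {0..}"
      using assms(2) \<open>\<omega> \<in> space M\<close>
      by (auto simp: poisson_point_process_def space_mark_lebesgue_def space_restrict_space)
    ultimately show False by (auto simp: interferers_def)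
  qed
qed

text \<open>Interferers only accumulate as \<open>d\<close> grows, so marks up to 1 suffice. Almost
  surely such points have positions outside every disc of integer radius; an unbounded set of
  positions is infinite even if the projection were to identify points.\<close>

lemma AE_interferers_infinite:
  assumes "prob_space M" "poisson_point_process M space_mark_lebesgue \<Phi>"
  shows "AE \<omega> in M. \<forall>d\<ge>1. infinite (interferers d (\<Phi> \<omega>))"
proof -
  have "AE \<omega> in M. \<Phi> \<omega> \<inter> ((- cball 0 (real R)) \<times> {0..1}) \<noteq> {}" for R :: nat
  proof (rule poisson_infinite_measure_AE_nonempty[OF assms])
    let ?A = "\<lambda>n. (cball 0 (real (R + n)) - cball 0 (real R)) :: (real^2) set"
    have A: "?A n \<in> sets lborel" "emeasure lborel (?A n) < \<infinity>" for n
      using lborel_ring_plane(1)[of "real R" "real (R + n)" "0::real^2"] by auto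
    note slab = space_mark_lebesgue_slab[OF A zero_le_one]
    show "?A n \<times> {0..1::real} \<in> sets space_mark_lebesgue" for n by (rule slab)
    show "emeasure space_mark_lebesgue (?A n \<times> {0..1}) < \<infinity>" for n by (rule slab)
    show "?A n \<times> {0..1::real} \<subseteq> (- cball 0 (real R)) \<times> {0..1}" for n by auto
    have "real n \<le> pi * ((real (R + n))\<^sup>2 - (real R)\<^sup>2)" for n
    proof -
      have "real n \<le> (real n)\<^sup>2" by (cases n) (simp_all add: power2_eq_square)
      also have "\<dots> \<le> (real (R + n))\<^sup>2 - (real R)\<^sup>2" by (simp add: power2_sum)
      also have "\<dots> \<le> pi * ((real (R + n))\<^sup>2 - (real R)\<^sup>2)"
        using pi_ge_two mult_right_mono[of 1 pi "(real (R + n))\<^sup>2 - (real R)\<^sup>2"]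
        by (simp add: power2_sum)
      finally show ?thesis .
    qed
    then have "filterlim (\<lambda>n. pi * ((real (R + n))\<^sup>2 - (real R)\<^sup>2)) at_top sequentially"
      by (intro filterlim_at_top_mono[OF filterlim_real_sequentially] always_eventually allI)
    then show "filterlim (\<lambda>n. measure space_mark_lebesgue (?A n \<times> {0..1})) at_top sequentially"
      by (subst slab(3), subst lborel_ring_plane(2)) simp_all
  qed
  then have "AE \<omega> in M. \<forall>R::nat. \<Phi> \<omega> \<inter> ((- cball 0 (real R)) \<times> {0..1}) \<noteq> {}"
    by (simp add: AE_all_countable)
  then show ?thesis
  proof eventually_elim
    case (elim \<omega>)
    show ?case
    proof (intro allI impI notI)
      fix d :: real assume d: "1 \<le> d" and fin: "finite (interferers d (\<Phi> \<omega>))"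
      from finite_imp_bounded[OF fin] obtain b where b: "\<forall>x\<in>interferers d (\<Phi> \<omega>). norm x \<le> b"
        unfolding bounded_iff ..
      obtain R :: nat where R: "b \<le> real R" using real_arch_simple by blast
      from elim have "\<Phi> \<omega> \<inter> ((- cball 0 (real R)) \<times> {0..1}) \<noteq> {}" by (rule spec)
      then obtain x u where xu: "(x, u) \<in> \<Phi> \<omega>" "x \<notin> cball 0 (real R)" "u \<le> 1" by auto
      have "x \<in> interferers d (\<Phi> \<omega>)"
        unfolding interferers_def using xu(1,3) d by (intro CollectI exI[of _ u] conjI) auto
      with b have "norm x \<le> b" ..
      with xu(2) R show False by simp
    qed
  qed
qed

section \<open>Annuli with geometric radii and the interference from outside\<close>

text \<open>Counting the disc as number 0 lets one law of large numbers control both the near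
  interferers and the far rings.\<close>

primrec annulus :: "real^2 \<Rightarrow> real \<Rightarrow> real \<Rightarrow> nat \<Rightarrow> (real^2) set" where
  "annulus y r q 0 = cball y r"
| "annulus y r q (Suc i) = cball y (r * q ^ Suc i) - cball y (r * q ^ i)"

lemma cball_subset_annuli: "cball y (r * q ^ n) \<subseteq> (\<Union>i\<le>n. annulus y r q i)"
proof (induction n)
  case (Suc n)
  have "cball y (r * q ^ Suc n) \<subseteq> annulus y r q (Suc n) \<union> cball y (r * q ^ n)" by auto
  with Suc show ?case by (simp only: atMost_Suc) blast
qed simp

lemma ex_geometric_radius:
  assumes "0 < r" "1 < (q::real)"
  shows "\<exists>n. s \<le> r * q ^ n"
proof -
  obtain n where "s / r < q ^ n" using real_arch_pow[OF assms(2)] by blast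
  then show ?thesis using assms by (intro exI[of _ n]) (simp add: field_simps)
qed

lemma lborel_annulus:
  fixes y :: "real^2"
  assumes "0 < r" "1 < q"
  shows "annulus y r q i \<in> sets lborel" "emeasure lborel (annulus y r q i) < \<infinity>"
    and "measure lborel (annulus y r q 0) = pi * r\<^sup>2"
    and "measure lborel (annulus y r q (Suc i)) = pi * r\<^sup>2 * (q\<^sup>2 - 1) * (q\<^sup>2) ^ i"
proof -
  have le: "0 \<le> r * q ^ i" "r * q ^ i \<le> r * q ^ Suc i" for i
    using assms by auto
  show "annulus y r q i \<in> sets lborel" by (cases i) auto
  show "emeasure lborel (annulus y r q i) < \<infinity>"
    using lborel_ring_plane(1)[OF le, of y] lborel_cball_plane(1)[of r y] assms(1) by (cases i) auto
  show "measure lborel (annulus y r q 0) = pi * r\<^sup>2"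
    using assms by (simp add: lborel_cball_plane)
  show "measure lborel (annulus y r q (Suc i)) = pi * r\<^sup>2 * (q\<^sup>2 - 1) * (q\<^sup>2) ^ i"
    using lborel_ring_plane(2)[OF le, of y i]
    by (simp add: power_mult_distrib power_mult[symmetric] mult.commute[of 2] algebra_simps)
qed

text \<open>Ring areas grow geometrically with ratio \<open>q^2\<close>; this provides the
  summability that the law of large numbers requires.\<close>

lemma summable_inverse_lborel_annulus:
  fixes y :: "real^2"
  assumes "0 < r" "1 < q"
  shows "summable (\<lambda>i. 1 / measure lborel (annulus y r q i))"
proof -
  have "1 / q\<^sup>2 < 1" using assms by (simp add: divide_less_eq)
  then have "summable (\<lambda>i. (1 / (pi * r\<^sup>2 * (q\<^sup>2 - 1))) * (1 / q\<^sup>2) ^ i)"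
    by (intro summable_mult summable_geometric) simp
  then have "summable (\<lambda>i. 1 / measure lborel (annulus y r q (Suc i)))"
    unfolding lborel_annulus(4)[OF assms] by (simp add: power_one_over)
  then show ?thesis by (subst (asm) summable_Suc_iff)
qed

text \<open>Each point of a ring is charged the power at the inner radius. From one ring to the next
  the area gains a factor \<open>q^2\<close> and the power a factor \<open>q powr - \<beta>\<close>;
  their product is below 1 because \<open>\<beta> > 2\<close>, so a geometric series
  results.\<close>

lemma interference_tail_bound:
  fixes X :: "(real^2) set"
  assumes pos: "2 < \<beta>" "0 \<le> Q" "0 < r" "1 < q" "0 \<le> c"
    and X: "\<And>i. finite (X \<inter> annulus y r q i)"
      "\<And>i. real (card (X \<inter> annulus y r q i)) \<le> c * measure lborel (annulus y r q i)"
    and F: "finite F" "F \<subseteq> X - cball y r"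
  shows "(\<Sum>x\<in>F. path_loss \<beta> (dist x y) * Q)
           \<le> c * (pi * r\<^sup>2) * (path_loss \<beta> r * Q) * ((q\<^sup>2 - 1) / (1 - q powr (2 - \<beta>)))"
proof -
  define g where "g x = path_loss \<beta> (dist x y) * Q" for x
  define w where "w = q powr (2 - \<beta>)"
  have w: "0 < w" "w < 1"
    using pos powr_less_mono[of "2 - \<beta>" 0 q] by (auto simp: w_def)
  \<comment> \<open>Picks one ring for each point so that the sum over \<open>F\<close> can be
    grouped; the disc, number 0, is excluded as \<open>F\<close> avoids it.\<close>
  define i where "i x = (LEAST i. x \<in> annulus y r q (Suc i))" for x
  have ex: "\<exists>i. x \<in> annulus y r q (Suc i)" if "x \<in> F" for x
  proof -
    obtain n where "x \<in> cball y (r * q ^ n)"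
      using ex_geometric_radius[of r q "dist y x"] pos by auto
    then obtain j where j: "x \<in> annulus y r q j" using cball_subset_annuli by blast
    moreover have "x \<notin> cball y r" using that F by auto
    ultimately show ?thesis by (cases j) auto
  qed
  have i: "x \<in> annulus y r q (Suc (i x))" if "x \<in> F" for x
    unfolding i_def using ex[OF that] by (rule LeastI_ex)
  obtain n where n: "i ` F \<subseteq> {..<n}"
    using finite_nat_bounded[of "i ` F"] F by blast
  define K where "K = c * (pi * r\<^sup>2) * (path_loss \<beta> r * Q) * (q\<^sup>2 - 1)"
  have K: "0 \<le> K" using pos by (auto simp: K_def path_loss_def)
  have ring: "(\<Sum>x\<in>{x\<in>F. i x = j}. g x) \<le> K * w ^ j" for j
  proof -
    have gb: "g x \<le> path_loss \<beta> (r * q ^ j) * Q" if "x \<in> F" "i x = j" for x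
      using i[OF that(1)] that pos unfolding g_def
      by (intro mult_right_mono path_loss_antimono) (auto simp: dist_commute)
    have pl: "path_loss \<beta> (r * q ^ j) = path_loss \<beta> r * (q powr - \<beta>) ^ j"
      using pos by (simp add: path_loss_def powr_mult powr_power flip: powr_realpow)
         (simp add: powr_powr mult.commute)
    have w_eq: "w = q\<^sup>2 * q powr - \<beta>"
      using pos by (simp add: w_def powr_diff powr_minus divide_inverse)
    have "(\<Sum>x\<in>{x\<in>F. i x = j}. g x) \<le> real (card {x\<in>F. i x = j}) * (path_loss \<beta> (r * q ^ j) * Q)"
      using gb by (intro sum_bounded_above) auto
    also have "\<dots> \<le> (c * measure lborel (annulus y r q (Suc j))) * (path_loss \<beta> (r * q ^ j) * Q)"
    proof (rule mult_right_mono)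
      have "card {x\<in>F. i x = j} \<le> card (X \<inter> annulus y r q (Suc j))"
        using i F by (intro card_mono X) auto
      then show "real (card {x\<in>F. i x = j}) \<le> c * measure lborel (annulus y r q (Suc j))"
        using X(2)[of "Suc j"] by linarith
    qed (use pos in \<open>simp add: path_loss_def\<close>)
    also have "\<dots> = K * w ^ j"
      unfolding lborel_annulus(4)[OF pos(3,4)] pl K_def w_eq power_mult_distrib by (simp only: ac_simps)
    finally show ?thesis .
  qed
  have "(\<Sum>x\<in>F. g x) = (\<Sum>j<n. \<Sum>x\<in>{x\<in>F. i x = j}. g x)"
    using F n by (intro sum.group[symmetric]) auto
  also have "\<dots> \<le> (\<Sum>j<n. K * w ^ j)" by (intro sum_mono ring)
  also have "\<dots> = K * (\<Sum>j<n. w ^ j)" by (simp add: sum_distrib_left)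
  also have "\<dots> \<le> K * (1 / (1 - w))"
  proof (rule mult_left_mono[OF _ K])
    show "(\<Sum>j<n. w ^ j) \<le> 1 / (1 - w)"
      using w sum_le_suminf[of "\<lambda>j. w ^ j" "{..<n}"] suminf_geometric[of w] by simp
  qed
  finally show ?thesis by (simp add: g_def K_def w_def)
qed

section \<open>Stability of the rate condition, and the conclusion\<close>

text \<open>As \<open>\<delta>\<close> tends to 0 from the right with
  \<open>q = 1 + \<delta>\<close>, the geometric-series factor tends to
  \<open>2 / (\<beta> - 2)\<close>, so the perturbed inequality tends to the strict hypothesis. The
  extra summand \<open>\<delta>\<close> in \<open>(1 + \<delta>) * \<rho> + \<delta>\<close> makes
  room for the tagged user, the 1 in \<open>l + 1\<close>.\<close>

lemma rate_condition_stable: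
  fixes \<beta> \<rho> P R :: real
  assumes "2 < \<beta>" "0 < \<rho>" "0 < P" and lt: "\<rho> * R < C (\<rho> * P / (1 + 2 * \<rho> * P / (\<beta> - 2)))"
  shows "\<exists>\<delta>>0. ((1 + \<delta>) * \<rho> + \<delta>) * R
    < C (((1 + \<delta>) * \<rho> + \<delta>) * P /
        (1 + (1 + \<delta>) * \<rho> * P * (((1 + \<delta>)\<^sup>2 - 1) / (1 - (1 + \<delta>) powr (2 - \<beta>)))))"
proof -
  have lim: "((\<lambda>\<delta>. ((1 + \<delta>)\<^sup>2 - 1) / (1 - (1 + \<delta>) powr (2 - \<beta>))) \<longlongrightarrow> 2 / (\<beta> - 2)) (at_right 0)"
    using assms(1) unfolding divide_inverse[of 2 "\<beta> - 2"] by real_asymp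
  let ?t = "\<lambda>\<delta>::real. (1 + \<delta>) * \<rho> + \<delta>"
  let ?D = "\<lambda>\<delta>. 1 + (1 + \<delta>) * \<rho> * P * (((1 + \<delta>)\<^sup>2 - 1) / (1 - (1 + \<delta>) powr (2 - \<beta>)))"
  have t: "(?t \<longlongrightarrow> (1 + 0) * \<rho> + 0) (at_right 0)"
    by (intro tendsto_intros)
  have D: "(?D \<longlongrightarrow> 1 + (1 + 0) * \<rho> * P * (2 / (\<beta> - 2))) (at_right 0)"
    by (intro tendsto_intros lim)
  have D0: "0 < 1 + (1 + 0) * \<rho> * P * (2 / (\<beta> - 2))"
    using assms by (intro add_pos_nonneg) auto
  have lim_C: "((\<lambda>\<delta>. C (?t \<delta> * P / ?D \<delta>) - ?t \<delta> * R)
      \<longlongrightarrow> C (((1 + 0) * \<rho> + 0) * P / (1 + (1 + 0) * \<rho> * P * (2 / (\<beta> - 2)))) - ((1 + 0) * \<rho> + 0) * R) (at_right 0)"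
  proof -
    have q: "((\<lambda>\<delta>. ?t \<delta> * P / ?D \<delta>)
        \<longlongrightarrow> ((1 + 0) * \<rho> + 0) * P / (1 + (1 + 0) * \<rho> * P * (2 / (\<beta> - 2)))) (at_right 0)"
      by (rule tendsto_divide[OF tendsto_mult[OF t tendsto_const] D]) (use D0 in simp)
    have "0 \<le> ((1 + 0) * \<rho> + 0) * P / (1 + (1 + 0) * \<rho> * P * (2 / (\<beta> - 2)))"
      using D0 assms(2,3) by (intro divide_nonneg_nonneg) auto
    then show ?thesis
      unfolding C_def
      by (intro tendsto_diff tendsto_mult[OF t tendsto_const]
            tendsto_log[OF tendsto_const tendsto_add[OF tendsto_const q]]) linarith+
  qed
  have "0 < C (((1 + 0) * \<rho> + 0) * P / (1 + (1 + 0) * \<rho> * P * (2 / (\<beta> - 2)))) - ((1 + 0) * \<rho> + 0) * R"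
    using lt by (simp add: ac_simps)
  from order_tendstoD(1)[OF lim_C this] have "\<forall>\<^sub>F \<delta> in at_right 0. 0 < C (?t \<delta> * P / ?D \<delta>) - ?t \<delta> * R" .
  moreover have "\<forall>\<^sub>F \<delta> in at_right 0. (0::real) < \<delta>" by (simp add: eventually_at_right_less)
  ultimately have "\<forall>\<^sub>F \<delta> in at_right 0. 0 < \<delta> \<and> ?t \<delta> * R < C (?t \<delta> * P / ?D \<delta>)"
    by eventually_elim auto
  then show ?thesis using eventually_happens'[OF trivial_limit_at_right_real] by blast
qed

theorem theorem5:
  fixes M :: "'a measure"
    and \<Phi> :: "'a \<Rightarrow> ((real^2) \<times> real) set"
    and y :: "real^2"
    and \<beta> Qb r0 Rb \<kappa> \<rho> Pb0 :: real
  assumes "prob_space M"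
    and "poisson_point_process M space_mark_lebesgue \<Phi>"
    and "\<beta> > 2" and "Qb > 0" and "r0 > 0" and "Rb > 0" and "\<kappa> > 0"
    and "\<rho> = \<kappa> * pi * r0\<^sup>2"
    and "Pb0 = path_loss \<beta> r0 * Qb"
  shows "C (\<rho> * Pb0 / (1 + 2 * \<rho> * Pb0 / (\<beta> - 2)))
           = C (\<rho> * Pb0 / (1 + 2 * pi * \<kappa> * Qb / (r0 powr (\<beta> - 2) * (\<beta> - 2)))) \<and>
         (\<rho> * Rb < C (\<rho> * Pb0 / (1 + 2 * \<rho> * Pb0 / (\<beta> - 2))) \<longrightarrow>
           (AE \<omega> in M. \<forall>\<^sub>F B in at_top.
              opt_decodable (path_loss \<beta>) Qb r0 Rb y B (interferers (\<kappa> * B) (\<Phi> \<omega>))))"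
proof (intro conjI impI)
  have "\<rho> * Pb0 = pi * \<kappa> * Qb / r0 powr (\<beta> - 2)"
  proof -
    have "r0\<^sup>2 * r0 powr (- \<beta>) = 1 / r0 powr (\<beta> - 2)"
      using assms(5) by (simp add: powr_diff powr_minus divide_inverse)
    then show ?thesis unfolding assms(8,9) path_loss_def
      by (simp add: divide_inverse ac_simps)
  qed
  then have "2 * \<rho> * Pb0 / (\<beta> - 2) = 2 * (pi * \<kappa> * Qb / r0 powr (\<beta> - 2)) / (\<beta> - 2)"
    by (simp only: mult.assoc)
  also have "\<dots> = 2 * pi * \<kappa> * Qb / (r0 powr (\<beta> - 2) * (\<beta> - 2))" by simp
  finally have "2 * \<rho> * Pb0 / (\<beta> - 2) = 2 * pi * \<kappa> * Qb / (r0 powr (\<beta> - 2) * (\<beta> - 2))" .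
  then show "C (\<rho> * Pb0 / (1 + 2 * \<rho> * Pb0 / (\<beta> - 2)))
           = C (\<rho> * Pb0 / (1 + 2 * pi * \<kappa> * Qb / (r0 powr (\<beta> - 2) * (\<beta> - 2))))"
    by simp
next
  assume rate: "\<rho> * Rb < C (\<rho> * Pb0 / (1 + 2 * \<rho> * Pb0 / (\<beta> - 2)))"
  note M = assms(1) and P = assms(2)
  have \<rho>: "0 < \<rho>" and Pb0: "0 < Pb0"
    using assms by (simp_all add: path_loss_def)
  obtain \<delta> where \<delta>: "0 < \<delta>"
    and rate': "((1 + \<delta>) * \<rho> + \<delta>) * Rb
    < C (((1 + \<delta>) * \<rho> + \<delta>) * Pb0 /
        (1 + (1 + \<delta>) * \<rho> * Pb0 * (((1 + \<delta>)\<^sup>2 - 1) / (1 - (1 + \<delta>) powr (2 - \<beta>)))))"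
    using rate_condition_stable[OF assms(3) \<rho> Pb0 rate] by blast
  define q where "q = 1 + \<delta>"
  have q: "1 < q" using \<delta> by (simp add: q_def)
  \<comment> \<open>\<open>t\<close> will bound \<open>(l + 1) / B\<close>, and \<open>T\<close>
    below the interference per Hz from outside \<open>r0\<close>.\<close>
  define t where "t = (1 + \<delta>) * \<rho> + \<delta>"
  have t: "0 < t" using \<rho> \<delta> by (simp add: t_def add_pos_pos)
  define T where "T = (1 + \<delta>) * \<rho> * Pb0 * ((q\<^sup>2 - 1) / (1 - q powr (2 - \<beta>)))"
  have "q powr (2 - \<beta>) < 1" using powr_less_mono[of "2 - \<beta>" 0 q] q assms(3) by simp
  then have T: "0 \<le> T" unfolding T_def using \<delta> \<rho> Pb0 q by (intro mult_nonneg_nonneg divide_nonneg_nonneg) auto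
  have rate_t: "t * Rb < C (t * (Pb0 / (1 + T)))" using rate' by (simp add: t_def T_def q_def)
  let ?A = "annulus y r0 q"
  have Apos: "0 < measure lborel (?A i)" for i
    using assms(5) q by (cases i) (simp_all add: lborel_annulus(3,4) del: annulus.simps)
  have "AE \<omega> in M. \<forall>\<^sub>F d in at_top. \<forall>i.
           point_count \<Phi> (?A i \<times> {0..d}) \<omega> \<le> ennreal ((1 + \<delta>) * d * measure lborel (?A i))"
    using assms(5) q Apos
    by (intro poisson_upper_law_of_large_numbers[OF M P] lborel_annulus
        summable_inverse_lborel_annulus \<delta>) auto
  with AE_receiver_notin_interferers[OF M P, of y] AE_interferers_infinite[OF M P] AE_space[of M]
  show "AE \<omega> in M. \<forall>\<^sub>F B in at_top.
              opt_decodable (path_loss \<beta>) Qb r0 Rb y B (interferers (\<kappa> * B) (\<Phi> \<omega>))"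
  proof eventually_elim
    case (elim \<omega>)
    note y = elim(1) and inf = elim(2)
    have \<Phi>: "\<Phi> \<omega> \<subseteq> UNIV \<times> {0..}"
      using P elim(3) by (auto simp: poisson_point_process_def space_mark_lebesgue_def space_restrict_space)
    have "filterlim (\<lambda>B. \<kappa> * B) at_top at_top"
      using assms(7) by real_asymp
    from eventually_compose_filterlim[OF elim(4) this]
    have "\<forall>\<^sub>F B in at_top. \<forall>i. point_count \<Phi> (?A i \<times> {0..\<kappa> * B}) \<omega>
            \<le> ennreal ((1 + \<delta>) * (\<kappa> * B) * measure lborel (?A i))" .
    \<comment> \<open>The first bound makes the set of interferers infinite, the second absorbs the
      1 in \<open>l + 1\<close>.\<close>
    moreover have "\<forall>\<^sub>F B in at_top. 1 \<le> \<kappa> * B" "\<forall>\<^sub>F B in at_top. 1 \<le> \<delta> * B"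
      using assms(7) \<delta> by real_asymp+
    ultimately show ?case
    proof eventually_elim
      case (elim B)
      have B: "0 < B" using elim(2) assms(7) zero_less_mult_pos[of \<kappa> B] by linarith
      define X where "X = interferers (\<kappa> * B) (\<Phi> \<omega>)"
      have X: "finite (X \<inter> ?A i)"
        "real (card (X \<inter> ?A i)) \<le> (1 + \<delta>) * (\<kappa> * B) * measure lborel (?A i)" for i
        using interferers_Int_finite[OF elim(1)[THEN spec, of i] \<Phi>] \<delta> B assms(7) by (simp_all add: X_def)
      show ?case
        unfolding X_def[symmetric]
      proof (rule opt_decodableI)
        show "infinite X" "y \<notin> X" using inf y elim(2) by (simp_all add: X_def)
        show "finite (X \<inter> cball y r)" for r
        proof -
          obtain n where "r \<le> r0 * q ^ n" using ex_geometric_radius[OF assms(5) q] by blast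
          then have "cball y r \<subseteq> (\<Union>i\<le>n. ?A i)"
            using cball_subset_annuli[of y r0 q n] subset_cball[of r "r0 * q ^ n" y] by blast
          then have "X \<inter> cball y r \<subseteq> (\<Union>i\<le>n. X \<inter> ?A i)" by blast
          then show ?thesis by (rule finite_subset) (intro finite_UN_I finite_atMost X(1))
        qed
        show "(\<Sum>x\<in>F. path_loss \<beta> (dist x y) * Qb) \<le> B * T"
          if "finite F" "F \<subseteq> X - cball y r0" for F
        proof -
          have "(\<Sum>x\<in>F. path_loss \<beta> (dist x y) * Qb)
            \<le> (1 + \<delta>) * (\<kappa> * B) * (pi * r0\<^sup>2) * (path_loss \<beta> r0 * Qb) * ((q\<^sup>2 - 1) / (1 - q powr (2 - \<beta>)))"
            using assms(4,7) \<delta> B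
            by (intro interference_tail_bound[OF assms(3) _ assms(5) q _ X that]) simp_all
          also have "\<dots> = B * T"
            unfolding T_def assms(8,9) by (simp only: ac_simps)
          finally show ?thesis .
        qed
        fix l assume l: "l \<le> card (X \<inter> cball y r0)"
        define s where "s = (real l + 1) / B"
        have s: "0 < s" using B by (simp add: s_def)
        \<comment> \<open>Annulus 0 is the disc of radius \<open>r0\<close>, so its count bounds
          \<open>l\<close>.\<close>
        have "real l \<le> (1 + \<delta>) * (\<kappa> * B) * (pi * r0\<^sup>2)"
          using l X(2)[of 0] lborel_annulus(3)[OF assms(5) q, of y] by simp
        then have "real l + 1 \<le> t * B"
          using elim(3) unfolding t_def assms(8) by (simp add: algebra_simps)
        then have st: "s \<le> t" using B by (simp add: s_def field_simps)
        \<comment> \<open>The inequality is known at \<open>t\<close>; decreasing chord slopes carry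
          it to every smaller \<open>s\<close>.\<close>
        have "t * (s * Rb) < s * C (t * (Pb0 / (1 + T)))"
          using mult_strict_left_mono[OF rate_t s] by (simp add: ac_simps)
        also have "\<dots> \<le> t * C (s * (Pb0 / (1 + T)))"
          using s st Pb0 T by (intro C_concave_at_0) auto
        finally have "s * Rb < C (s * (Pb0 / (1 + T)))" using t by simp
        then show "(real l + 1) * (Rb / B) < C ((real l + 1) * (path_loss \<beta> r0 * Qb / B) / (1 + T))"
          by (simp add: s_def assms(9))
      qed (use assms B T in auto)
    qed
  qed
qed

end
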